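(* Let $p$ be a prime, $q\in\mathbb{C}_p$ with $|q-1|_p<p^{-\frac{1}{p-1}}$, $\lambda\in\mathbb{C}_p\setminus\{0\}$, and $x\in\mathbb{Z}_p$. For every integer $n\ge0$, \[ \beta_{n,q}(x|\lambda)=\sum_{l=0}^n S_1(n,l)\lambda^{n-l}\beta_{l,q}(x). \]
   Context: $q^x=\exp(x\log q)$, $[x]_q=\frac{1-q^x}{1-q}$. The $p$-adic $q$-integral of a uniformly differentiable $f$ on $\mathbb{Z}_p$ is $\int_{\mathbb{Z}_p}f(y)\,d\mu_q(y)=\lim_{N\to\infty}\frac{1}{[p^N]_q}\sum_{y=0}^{p^N-1}f(y)q^y$. The Carlitz $q$-Bernoulli polynomials are $\beta_{n,q}(x)=\int_{\mathbb{Z}_p}[x+y]_q^n\,d\mu_q(y)$. For $t\in\mathbb{C}_p$ with $|\lambda t|_p<p^{-1/(p-1)}$, $(1+\lambda t)^{a/\lambda}=\exp(\frac{a}{\lambda}\log(1+\lambda t))$, and the degenerate Carlitz $q$-Bernoulli polynomials $\beta_{n,q}(x|\lambda)$ are defined by $\int_{\mathbb{Z}_p}(1+\lambda t)^{\frac{1}{\lambda}[x+y]_q}\,d\mu_q(y)=\sum_{n\ge0}\beta_{n,q}(x|\lambda)\frac{t^n}{n!}$. $S_1(n,l)$ are the (signed) Stirling numbers of the first kind: $x(x-1)\cdots(x-n+1)=\sum_{l=0}^nS_1(n,l)x^l$. *)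

theory Defs
  imports "HOL-Analysis.Elementary_Metric_Spaces"
    "HOL-Computational_Algebra.Polynomial"
    "HOL-Computational_Algebra.Primes"
begin

text \<open>
  Fields of characteristic 0 with a non-archimedean absolute value and its metric topology. (The
  class \<open>real_normed_field\<close> is not applicable, as it presupposes an \<open>\<real>\<close>-algebra, and \<open>norm\<close> is
  reserved for real normed vector spaces.)
\<close>

class nonarch_field = field_char_0 + metric_space +
  fixes absval :: "'a \<Rightarrow> real"
  assumes dist_absval: "dist x y = absval (x - y)"
    and absval_mult: "absval (x * y) = absval x * absval y"
    and absval_add_le: "absval (x + y) \<le> max (absval x) (absval y)"

section \<open>The field of complex \<open>p\<close>-adic numbers\<close>

text \<open>
  \<open>padic_complex p TYPE('a)\<close> states that \<open>'a\<close> is \<open>\<complex>\<^sub>p\<close>, i.e. the completion of an algebraic closure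
  of \<open>\<rat>\<^sub>p\<close>; this determines \<open>'a\<close> up to isometric isomorphism. For prime \<open>p\<close>, the ultrametric
  inequality and \<open>\<bar>p\<bar> = 1/p\<close> force \<open>absval\<close> to restrict to the \<open>p\<close>-adic absolute value on \<open>\<rat>\<close>,
  because an integer \<open>m\<close> prime to \<open>p\<close> has \<open>\<bar>m\<bar> = 1\<close> by Bezout. Hence, \<open>'a\<close> being complete, the closures
  of \<open>\<rat>\<close> and \<open>\<int>\<close> in \<open>'a\<close> are \<open>\<rat>\<^sub>p\<close> and \<open>\<int>\<^sub>p\<close>.
\<close>

definition padic_rats :: "'a::nonarch_field set" where
  "padic_rats = closure (range of_rat)"

definition padic_ints :: "'a::nonarch_field set" where
  "padic_ints = closure (range of_int)"

definition padic_algebraics :: "'a::nonarch_field set" where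
  "padic_algebraics = {x. \<exists>f. f \<noteq> 0 \<and> (\<forall>i. coeff f i \<in> padic_rats) \<and> poly f x = 0}"

definition padic_complex :: "nat \<Rightarrow> 'a::nonarch_field itself \<Rightarrow> bool" where
  "padic_complex p _ \<longleftrightarrow>
     absval (of_nat p :: 'a) = 1 / real p \<and>
     complete (UNIV :: 'a set) \<and>
     (\<forall>f :: 'a poly. degree f > 0 \<and> (\<forall>i. coeff f i \<in> padic_algebraics) \<longrightarrow>
        (\<exists>x \<in> padic_algebraics. poly f x = 0)) \<and>
     closure (padic_algebraics :: 'a set) = UNIV"

section \<open>Exponential, logarithm and powers\<close>

definition padic_exp :: "'a::nonarch_field \<Rightarrow> 'a" where
  "padic_exp x = (\<Sum>n. x ^ n / fact n)"

definition padic_log :: "'a::nonarch_field \<Rightarrow> 'a" where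
  "padic_log x = (\<Sum>n. (-1) ^ n * (x - 1) ^ Suc n / of_nat (Suc n))"

text \<open>The radius of convergence \<open>p\<^bsup>-1/(p-1)\<^esup>\<close> of the \<open>p\<close>-adic exponential.\<close>

definition exp_radius :: "nat \<Rightarrow> real" where
  "exp_radius p = real p powr (- 1 / (real p - 1))"

definition q_pow :: "'a::nonarch_field \<Rightarrow> 'a \<Rightarrow> 'a" where
  "q_pow q x = padic_exp (x * padic_log q)"

text \<open>For \<open>q = 1\<close> the quotient \<open>(1 - q\<^sup>x) / (1 - q)\<close> is read as its limit \<open>x\<close> for \<open>q \<rightarrow> 1\<close>.\<close>

definition q_number :: "'a::nonarch_field \<Rightarrow> 'a \<Rightarrow> 'a" where
  "q_number q x = (if q = 1 then x else (1 - q_pow q x) / (1 - q))"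

text \<open>\<open>degenerate_exp lam t a\<close> is \<open>(1 + lam t)\<^bsup>a/lam\<^esup>\<close>.\<close>

definition degenerate_exp :: "'a::nonarch_field \<Rightarrow> 'a \<Rightarrow> 'a \<Rightarrow> 'a" where
  "degenerate_exp lam t a = padic_exp (a / lam * padic_log (1 + lam * t))"

section \<open>The \<open>q\<close>-integral and Carlitz \<open>q\<close>-Bernoulli polynomials\<close>

definition q_integral :: "nat \<Rightarrow> 'a::nonarch_field \<Rightarrow> ('a \<Rightarrow> 'a) \<Rightarrow> 'a" where
  "q_integral p q f =
     lim (\<lambda>N. 1 / q_number q (of_nat (p ^ N)) * (\<Sum>y<p ^ N. f (of_nat y) * q_pow q (of_nat y)))"

definition carlitz_bernoulli :: "nat \<Rightarrow> nat \<Rightarrow> 'a::nonarch_field \<Rightarrow> 'a \<Rightarrow> 'a" where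
  "carlitz_bernoulli p n q x = q_integral p q (\<lambda>y. q_number q (x + y) ^ n)"

text \<open>
  The generating function identity is required wherever both sides make sense: besides \<open>\<bar>lam t\<bar>\<close>,
  also \<open>\<bar>t\<bar>\<close> has to be smaller than the radius of convergence of the exponential, since
  \<open>\<bar>a/lam log (1 + lam t)\<bar> = \<bar>a t\<bar>\<close> and \<open>a = [x + y]\<^sub>q\<close> may have absolute value 1.
\<close>

definition degenerate_carlitz_bernoulli ::
    "nat \<Rightarrow> nat \<Rightarrow> 'a::nonarch_field \<Rightarrow> 'a \<Rightarrow> 'a \<Rightarrow> 'a" where
  "degenerate_carlitz_bernoulli p n q x lam =
     (THE b :: nat \<Rightarrow> 'a. \<forall>t. absval (lam * t) < exp_radius p \<and> absval t < exp_radius p \<longrightarrow>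
        (\<lambda>k. b k * t ^ k / fact k) sums
          q_integral p q (\<lambda>y. degenerate_exp lam t (q_number q (x + y)))) n"

section \<open>Signed Stirling numbers of the first kind\<close>

definition stirling1 :: "nat \<Rightarrow> nat \<Rightarrow> int" where
  "stirling1 n l = coeff (\<Prod>i<n. [:- int i, 1:]) l"

lemma falling_factorial_eq_sum_stirling1:
  "(\<Prod>i<n. x - int i) = (\<Sum>l\<le>n. stirling1 n l * x ^ l)"
proof -
  have "degree (\<Prod>i<n. [:- int i, 1:]) = n"
    by (subst degree_prod_eq_sum_degree) auto
  then have "poly (\<Prod>i<n. [:- int i, 1:]) x = (\<Sum>l\<le>n. stirling1 n l * x ^ l)"
    by (simp only: poly_altdef stirling1_def)
  then show ?thesis
    by (simp add: poly_prod)
qed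

end

theory Submission
  imports Defs "HOL-Computational_Algebra.Formal_Power_Series"
begin

text \<open>
  Write \<open>a\<^sub>y = [x + y]\<^sub>q\<close> and \<open>L = log (1 + \<lambda>t) / \<lambda>\<close>. Then \<open>(1 + \<lambda>t)\<^bsup>a/\<lambda>\<^esup> = \<Sum>\<^sub>k a\<^sup>k L\<^sup>k / k!\<close>, and the
  \<open>q\<close>-Riemann sums of \<open>y \<mapsto> a\<^sub>y\<^sup>k\<close> converge to \<open>\<beta>\<^sub>k\<^sub>,\<^sub>q(x)\<close> and are bounded by \<open>p\<close> uniformly in \<open>k\<close>, because
  \<open>y \<mapsto> a\<^sub>y\<^sup>k q\<^sup>y\<close> is \<open>1\<close>-Lipschitz. Since \<open>L\<^sup>k / k!\<close> tends to \<open>0\<close>, limit and sum may be interchanged, so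
  that the generating function is \<open>\<Sum>\<^sub>k \<beta>\<^sub>k\<^sub>,\<^sub>q(x) L\<^sup>k / k!\<close>. Expanding
  \<open>L\<^sup>k / k! = \<Sum>\<^sub>n S\<^sub>1(n,k) \<lambda>\<^bsup>n-k\<^esup> t\<^sup>n / n!\<close> and reordering the double sum yields the claim, as the
  coefficients of a power series are determined by its values near \<open>0\<close>.
\<close>

section \<open>Ultrametric analysis\<close>

lemma absval_0 [simp]: "absval (0::'a::nonarch_field) = 0"
  using dist_absval[of 0 "0::'a"] by simp

lemma absval_eq_0_iff [simp]: "absval x = 0 \<longleftrightarrow> x = (0::'a::nonarch_field)"
  using dist_eq_0_iff[of x 0] by (simp add: dist_absval)

lemma absval_ge_0 [simp]: "0 \<le> absval (x::'a::nonarch_field)"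
  using dist_absval[of x 0] by (metis diff_zero zero_le_dist)

lemma absval_1 [simp]: "absval (1::'a::nonarch_field) = 1"
  using absval_mult[of "1::'a" 1] absval_eq_0_iff[of "1::'a"] by simp

lemma absval_minus [simp]: "absval (- x) = absval (x::'a::nonarch_field)"
  using dist_absval[of 0 x] dist_absval[of x 0] by (simp add: dist_commute)

lemma absval_power: "absval (x ^ n :: 'a::nonarch_field) = absval x ^ n"
  by (induction n) (simp_all add: absval_mult)

lemma absval_inverse: "absval (inverse x) = inverse (absval (x::'a::nonarch_field))"
proof (cases "x = 0")
  case False
  then have "absval x * absval (inverse x) = 1"
    by (metis absval_1 absval_mult right_inverse)
  then show ?thesis
    by (metis inverse_unique)
qed simp

lemma absval_divide: "absval (x / y :: 'a::nonarch_field) = absval x / absval y"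
  by (simp add: divide_inverse absval_mult absval_inverse)

lemma absval_add_leI: "absval (x::'a::nonarch_field) \<le> C \<Longrightarrow> absval y \<le> C \<Longrightarrow> absval (x + y) \<le> C"
  using absval_add_le[of x y] by linarith

lemma absval_diff_leI: "absval (x::'a::nonarch_field) \<le> C \<Longrightarrow> absval y \<le> C \<Longrightarrow> absval (x - y) \<le> C"
  using absval_add_leI[of x C "- y"] by simp

lemma absval_sum_le:
  "(\<And>i. i \<in> A \<Longrightarrow> absval (f i :: 'a::nonarch_field) \<le> C) \<Longrightarrow> 0 \<le> C \<Longrightarrow> absval (sum f A) \<le> C"
  by (induction A rule: infinite_finite_induct) (auto intro: absval_add_leI)

lemma absval_of_nat_le: "absval (of_nat n :: 'a::nonarch_field) \<le> 1"
  by (induction n) (auto intro: absval_add_leI)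

lemma absval_of_int_le: "absval (of_int k :: 'a::nonarch_field) \<le> 1"
  by (cases k rule: int_cases2) (auto simp: absval_of_nat_le)

lemma absval_mult_le_1: "absval (x::'a::nonarch_field) \<le> 1 \<Longrightarrow> absval y \<le> 1 \<Longrightarrow> absval (x * y) \<le> 1"
  by (simp add: absval_mult mult_le_one)

lemma absval_power_le_1: "absval (x::'a::nonarch_field) \<le> 1 \<Longrightarrow> absval (x ^ n) \<le> 1"
  by (simp add: absval_power power_le_one)

text \<open>The isosceles triangle principle: \<open>absval y\<close> is at most the maximum of
  \<open>absval (x - y)\<close> and \<open>absval x\<close>, and the first is excluded.\<close>

lemma absval_eq_of_diff_less:
  fixes x y :: "'a::nonarch_field"
  assumes "absval (x - y) < absval y"
  shows "absval x = absval y"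
proof (rule antisym)
  show "absval x \<le> absval y"
    using absval_add_le[of "x - y" y] assms by simp
  show "absval y \<le> absval x"
    using absval_add_le[of "- (x - y)" x] assms unfolding absval_minus by simp
qed

lemma tendsto_absval_iff:
  "((f :: _ \<Rightarrow> 'a::nonarch_field) \<longlongrightarrow> a) F \<longleftrightarrow> ((\<lambda>x. absval (f x - a)) \<longlongrightarrow> 0) F"
  by (subst tendsto_dist_iff) (simp add: dist_absval)

lemma tendsto_absval:
  fixes a :: "'a::nonarch_field"
  assumes "(f \<longlongrightarrow> a) F"
  shows "((\<lambda>x. absval (f x)) \<longlongrightarrow> absval a) F"
  using tendsto_dist[OF assms tendsto_const[of 0]] by (simp add: dist_absval)

lemma absval_tendsto_0I:
  fixes f :: "'b \<Rightarrow> 'a::nonarch_field"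
  assumes "\<And>x. absval (f x) \<le> g x" "(g \<longlongrightarrow> 0) F"
  shows "((\<lambda>x. absval (f x)) \<longlongrightarrow> 0) F"
  by (rule tendsto_sandwich[OF _ _ tendsto_const assms(2)]) (simp_all add: assms(1))

text \<open>Gives access to the library rules for limits and series under addition.\<close>

instance nonarch_field \<subseteq> topological_ab_group_add
proof
  fix a b :: 'a
  have "((\<lambda>x. max (absval (fst x - a)) (absval (snd x - b))) \<longlongrightarrow> max 0 0) (nhds a \<times>\<^sub>F nhds b)"
    by (intro tendsto_max tendsto_absval_iff[THEN iffD1] filterlim_fst filterlim_snd)
  then have "((\<lambda>x. max (absval (fst x - a)) (absval (snd x - b))) \<longlongrightarrow> 0) (nhds a \<times>\<^sub>F nhds b)"
    by simp
  then show "LIM x nhds a \<times>\<^sub>F nhds b. fst x + snd x :> nhds (a + b)"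
    unfolding tendsto_absval_iff
    by (rule absval_tendsto_0I[rotated]) (simp add: add_diff_add absval_add_le)
  have "((\<lambda>x. absval (x - a)) \<longlongrightarrow> 0) (nhds a)"
    using tendsto_absval_iff[THEN iffD1, OF filterlim_ident] .
  moreover have "absval (- x - - a) = absval (x - a)" for x
    using absval_minus[of "x - a"] by simp
  ultimately show "(uminus \<longlongrightarrow> - a) (nhds a)"
    unfolding tendsto_absval_iff by simp
qed

lemma tendsto_nonarch_mult_left:
  fixes c :: "'a::nonarch_field"
  assumes "(f \<longlongrightarrow> a) F"
  shows "((\<lambda>x. c * f x) \<longlongrightarrow> c * a) F"
proof -
  have "((\<lambda>x. absval c * absval (f x - a)) \<longlongrightarrow> absval c * 0) F"
    using assms by (intro tendsto_mult_left) (simp add: tendsto_absval_iff)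
  then show ?thesis
    by (subst tendsto_absval_iff) (simp add: absval_mult flip: right_diff_distrib)
qed

lemma sums_nonarch_mult:
  fixes c :: "'a::nonarch_field"
  assumes "f sums a"
  shows "(\<lambda>n. c * f n) sums (c * a)"
  using tendsto_nonarch_mult_left[OF assms[unfolded sums_def], of c]
  by (simp add: sums_def sum_distrib_left)

lemma sums_nonarch_diff:
  fixes a b :: "'a::nonarch_field"
  assumes "f sums a" "g sums b"
  shows "(\<lambda>n. f n - g n) sums (a - b)"
  using sums_add[OF assms(1) sums_nonarch_mult[OF assms(2), of "-1"]] by simp

lemma sums_absval_le:
  fixes s :: "'a::nonarch_field"
  assumes "f sums s" "\<And>n. absval (f n) \<le> C"
  shows "absval s \<le> C"
proof (rule LIMSEQ_le_const2)
  show "(\<lambda>n. absval (\<Sum>i<n. f i)) \<longlonglongrightarrow> absval s"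
    using assms(1) by (intro tendsto_absval) (simp add: sums_def)
  have "0 \<le> C"
    using assms(2)[of 0] absval_ge_0 order_trans by blast
  then show "\<exists>N. \<forall>n\<ge>N. absval (\<Sum>i<n. f i) \<le> C"
    using assms(2) by (auto intro: absval_sum_le)
qed

section \<open>Convergence criteria and interchange of limits\<close>

lemma summable_absval_tendsto_0:
  fixes f :: "nat \<Rightarrow> 'a::nonarch_field"
  assumes "summable f"
  shows "(\<lambda>n. absval (f n)) \<longlonglongrightarrow> 0"
proof -
  obtain s where s: "(\<lambda>n. \<Sum>i<n. f i) \<longlonglongrightarrow> s"
    using assms by (auto simp: summable_def sums_def)
  have "(\<lambda>n. (\<Sum>i<Suc n. f i) - (\<Sum>i<n. f i)) \<longlonglongrightarrow> s - s"
    unfolding diff_conv_add_uminus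
    by (intro tendsto_add tendsto_minus s s[THEN LIMSEQ_Suc])
  then have "f \<longlonglongrightarrow> 0"
    by simp
  then show ?thesis
    by (simp add: tendsto_absval_iff)
qed

text \<open>A telescoping sum is bounded by its largest increment, so increments tending to 0
  already make \<open>X\<close> a Cauchy sequence.\<close>

lemma nonarch_convergentI:
  fixes X :: "nat \<Rightarrow> 'a::nonarch_field"
  assumes "complete (UNIV :: 'a set)"
    and lim: "(\<lambda>n. absval (X (Suc n) - X n)) \<longlonglongrightarrow> 0"
  shows "convergent X"
proof -
  have "Cauchy X"
  proof (rule metric_CauchyI)
    fix e :: real assume "0 < e"
    then obtain M where M: "\<And>n. n \<ge> M \<Longrightarrow> absval (X (Suc n) - X n) < e / 2"
      using order_tendstoD(2)[OF lim, of "e / 2"] by (auto simp: eventually_sequentially)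
    have *: "absval (X (M + k) - X M) \<le> e / 2" for k
    proof (induction k)
      case (Suc k)
      show ?case
        using absval_add_leI[OF M[THEN less_imp_le] Suc.IH, of "M + k"] by simp
    qed (use \<open>0 < e\<close> in simp)
    have "dist (X m) (X n) < e" if "m \<ge> M" "n \<ge> M" for m n
      using absval_diff_leI[OF *[of "m - M"] *[of "n - M"]] that \<open>0 < e\<close>
      by (simp add: dist_absval)
    then show "\<exists>M. \<forall>m\<ge>M. \<forall>n\<ge>M. dist (X m) (X n) < e"
      by blast
  qed
  with assms(1) show ?thesis
    by (auto simp: complete_def convergent_def)
qed

lemma nonarch_summableI:
  fixes f :: "nat \<Rightarrow> 'a::nonarch_field"
  assumes "complete (UNIV :: 'a set)" "(\<lambda>n. absval (f n)) \<longlonglongrightarrow> 0"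
  shows "summable f"
  using nonarch_convergentI[of "\<lambda>n. \<Sum>i<n. f i"] assms by (simp add: summable_iff_convergent)

lemma nonarch_summable_geometric:
  fixes f :: "nat \<Rightarrow> 'a::nonarch_field"
  assumes "complete (UNIV :: 'a set)" "\<And>n. absval (f n) \<le> \<rho> ^ n" "0 \<le> \<rho>" "\<rho> < 1"
  shows "summable f"
  using assms
  by (intro nonarch_summableI absval_tendsto_0I[OF _ LIMSEQ_power_zero[of \<rho>]]) auto

text \<open>Keeping only the rows \<open>k < K\<close> leaves the columns \<open>n < K\<close>
  untouched and changes each column \<open>n \<ge> K\<close> by at most \<open>g n\<close>; by the
  ultrametric inequality the total then changes by at most the largest of these bounds.\<close>

lemma sums_triangular_swap:
  fixes f :: "nat \<Rightarrow> nat \<Rightarrow> 'a::nonarch_field"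
  assumes "complete (UNIV :: 'a set)"
    and zero: "\<And>k n. n < k \<Longrightarrow> f k n = 0"
    and bound: "\<And>k n. absval (f k n) \<le> g n" and lim: "g \<longlonglongrightarrow> 0"
    and s: "\<And>k. f k sums s k"
  shows "\<exists>S. (\<lambda>n. \<Sum>k\<le>n. f k n) sums S \<and> s sums S"
proof -
  have g: "0 \<le> g n" for n
    using bound[of 0 n] absval_ge_0 order_trans by blast
  have "(\<lambda>n. absval (\<Sum>k\<le>n. f k n)) \<longlonglongrightarrow> 0"
    by (rule absval_tendsto_0I[OF _ lim]) (intro absval_sum_le bound g)
  then obtain S where S: "(\<lambda>n. \<Sum>k\<le>n. f k n) sums S"
    using nonarch_summableI[OF assms(1)] by (metis summable_def)
  have "(\<lambda>K. \<Sum>k<K. s k) \<longlonglongrightarrow> S"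
  proof (rule metric_LIMSEQ_I)
    fix e :: real assume "0 < e"
    then obtain M where M: "\<And>n. n \<ge> M \<Longrightarrow> g n < e / 2"
      using order_tendstoD(2)[OF lim, of "e / 2"] by (auto simp: eventually_sequentially)
    have "dist (\<Sum>k<K. s k) S < e" if "K \<ge> M" for K
    proof -
      have "absval ((\<Sum>k<K. s k) - S) \<le> e / 2"
      proof (rule sums_absval_le)
        show "(\<lambda>n. (\<Sum>k<K. f k n) - (\<Sum>k\<le>n. f k n)) sums ((\<Sum>k<K. s k) - S)"
          by (intro sums_nonarch_diff sums_sum s S)
        show "absval ((\<Sum>k<K. f k n) - (\<Sum>k\<le>n. f k n)) \<le> e / 2" for n
        proof (cases "n < K")
          case True
          then have "(\<Sum>k<K. f k n) = (\<Sum>k\<le>n. f k n)"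
            by (intro sum.mono_neutral_right) (auto intro: zero)
          with \<open>0 < e\<close> show ?thesis by simp
        next
          case False
          with \<open>K \<ge> M\<close> have "absval (f k n) \<le> e / 2" for k
            using bound[of k n] M[of n] by simp
          then show ?thesis
            using \<open>0 < e\<close> by (intro absval_diff_leI absval_sum_le) auto
        qed
      qed
      with \<open>0 < e\<close> show ?thesis
        by (simp add: dist_absval)
    qed
    then show "\<exists>M. \<forall>K\<ge>M. dist (\<Sum>k<K. s k) S < e"
      by blast
  qed
  with S show ?thesis
    by (auto simp: sums_def)
qed

lemma absval_Cauchy_product_le:
  fixes a b :: "nat \<Rightarrow> 'a::nonarch_field"
  assumes "\<And>n. absval (a n) \<le> \<rho> ^ n" "\<And>n. absval (b n) \<le> \<rho> ^ n" "0 \<le> \<rho>"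
  shows "absval (\<Sum>i\<le>n. a i * b (n - i)) \<le> \<rho> ^ n"
proof (rule absval_sum_le)
  fix i assume "i \<in> {..n}"
  then have "absval (a i * b (n - i)) \<le> \<rho> ^ i * \<rho> ^ (n - i)"
    using assms by (simp add: absval_mult mult_mono')
  with \<open>i \<in> {..n}\<close> show "absval (a i * b (n - i)) \<le> \<rho> ^ n"
    by (simp flip: power_add)
qed (use assms in simp)

text \<open>An instance of the triangular interchange: row \<open>k\<close> is \<open>a k\<close>
  times the sequence \<open>b\<close> shifted by \<open>k\<close> places, and the column sums form
  the convolution.\<close>

lemma nonarch_Cauchy_product:
  fixes a b :: "nat \<Rightarrow> 'a::nonarch_field"
  assumes complete: "complete (UNIV :: 'a set)"
    and a: "\<And>n. absval (a n) \<le> \<rho> ^ n" and b: "\<And>n. absval (b n) \<le> \<rho> ^ n"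
    and \<rho>: "0 \<le> \<rho>" "\<rho> < 1"
    and "a sums A" "b sums B"
  shows "(\<lambda>n. \<Sum>i\<le>n. a i * b (n - i)) sums (A * B)"
proof -
  define f where "f k n = (if k \<le> n then a k * b (n - k) else 0)" for k n
  have "f k sums (a k * B)" for k
  proof -
    have "(\<lambda>n. \<Sum>i<n + k. f k i) = (\<lambda>n. \<Sum>i<n. a k * b i)"
    proof
      fix n
      have "(\<Sum>i<n + k. f k i) = (\<Sum>i\<in>{0 + k..<n + k}. f k i)"
        by (intro sum.mono_neutral_right) (auto simp: f_def)
      also have "\<dots> = (\<Sum>i<n. a k * b i)"
        by (subst sum.shift_bounds_nat_ivl) (simp add: f_def atLeast0LessThan)
      finally show "(\<Sum>i<n + k. f k i) = (\<Sum>i<n. a k * b i)" .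
    qed
    with sums_nonarch_mult[OF \<open>b sums B\<close>, of "a k"]
    have "(\<lambda>n. \<Sum>i<n + k. f k i) \<longlonglongrightarrow> a k * B"
      by (simp add: sums_def)
    then show ?thesis
      unfolding sums_def by (rule LIMSEQ_offset)
  qed
  moreover have "absval (f k n) \<le> \<rho> ^ n" for k n
  proof (cases "k \<le> n")
    case True
    then have "absval (a k * b (n - k)) \<le> \<rho> ^ k * \<rho> ^ (n - k)"
      using a b \<rho> by (simp add: absval_mult mult_mono')
    with True show ?thesis
      by (simp add: f_def flip: power_add)
  qed (use \<rho> in \<open>simp add: f_def\<close>)
  ultimately obtain S where S: "(\<lambda>n. \<Sum>k\<le>n. f k n) sums S" "(\<lambda>k. a k * B) sums S"
    using sums_triangular_swap[of f "\<lambda>n. \<rho> ^ n" "\<lambda>k. a k * B"] complete \<rho>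
    by (auto simp: f_def LIMSEQ_power_zero)
  have "(\<lambda>k. a k * B) sums (A * B)"
    using sums_nonarch_mult[OF \<open>a sums A\<close>, of B] by (simp add: mult.commute)
  with S(2) have "S = A * B"
    by (rule sums_unique2)
  with S(1) show ?thesis
    by (simp add: f_def)
qed

text \<open>Dominated convergence for series. A tail is bounded by its largest term, so a majorant
  \<open>g\<close> tending to 0 takes the place of a summable one; the finitely many
  \<open>k < M\<close> are handled by pointwise convergence.\<close>

lemma nonarch_tannery:
  fixes u :: "nat \<Rightarrow> nat \<Rightarrow> 'a::nonarch_field"
  assumes complete: "complete (UNIV :: 'a set)"
    and u: "\<And>k. (\<lambda>N. u N k) \<longlonglongrightarrow> v k"
    and bound: "\<And>N k. absval (u N k) \<le> g k" and g: "g \<longlonglongrightarrow> 0"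
    and s: "\<And>N. u N sums s N"
  shows "s \<longlonglongrightarrow> suminf v" "v sums suminf v"
proof -
  have v: "absval (v k) \<le> g k" for k
    using LIMSEQ_le_const2[OF tendsto_absval[OF u[of k]]] bound by blast
  then have "summable v"
    by (intro nonarch_summableI complete absval_tendsto_0I[OF _ g])
  then show *: "v sums suminf v"
    by (rule summable_sums)
  show "s \<longlonglongrightarrow> suminf v"
  proof (rule metric_LIMSEQ_I)
    fix e :: real assume "0 < e"
    then obtain M where M: "\<And>k. k \<ge> M \<Longrightarrow> g k < e / 2"
      using order_tendstoD(2)[OF g, of "e / 2"] by (auto simp: eventually_sequentially)
    have "\<forall>k\<in>{..<M}. eventually (\<lambda>N. absval (u N k - v k) < e / 2) sequentially"
      using u \<open>0 < e\<close> by (auto simp: tendsto_absval_iff intro: order_tendstoD(2)[of _ 0])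
    then have "eventually (\<lambda>N. \<forall>k\<in>{..<M}. absval (u N k - v k) < e / 2) sequentially"
      by (simp add: eventually_ball_finite)
    then obtain N0 where N0: "\<And>N k. N \<ge> N0 \<Longrightarrow> k < M \<Longrightarrow> absval (u N k - v k) < e / 2"
      by (auto simp: eventually_sequentially)
    have "dist (s N) (suminf v) < e" if "N \<ge> N0" for N
    proof -
      have "absval (s N - suminf v) \<le> e / 2"
      proof (rule sums_absval_le[OF sums_nonarch_diff[OF s *]])
        show "absval (u N k - v k) \<le> e / 2" for k
        proof (cases "k < M")
          case True
          then show ?thesis using N0 that by (simp add: less_imp_le)
        next
          case False
          then show ?thesis
            using bound[of N k] v[of k] M[of k] by (intro absval_diff_leI) auto
        qed
      qed
      with \<open>0 < e\<close> show ?thesis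
        by (simp add: dist_absval)
    qed
    then show "\<exists>N0. \<forall>N\<ge>N0. dist (s N) (suminf v) < e"
      by blast
  qed
qed

section \<open>Exponential and logarithm\<close>

locale padic_complex_field =
  fixes p :: nat and T :: "'a::nonarch_field itself"
  assumes prime_p: "prime p" and padic_complex: "padic_complex p T"
begin

abbreviation r :: real where "r \<equiv> exp_radius p"

lemma p_gt_1: "1 < p"
  using prime_p by (rule prime_gt_1_nat)

lemma complete_UNIV: "complete (UNIV :: 'a set)"
  using padic_complex by (simp add: padic_complex_def)

lemma absval_p: "absval (of_nat p :: 'a) = 1 / p"
  using padic_complex by (simp add: padic_complex_def)

lemma absval_p_power: "absval (of_nat (p ^ N) :: 'a) = (1 / p) ^ N"
  by (simp only: of_nat_power absval_power absval_p)

text \<open>Otherwise both summands of a Bezout identity \<open>a * n + b * p = 1\<close> would have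
  absolute value below 1, and so would 1.\<close>

lemma absval_of_nat_coprime:
  assumes "\<not> p dvd n"
  shows "absval (of_nat n :: 'a) = 1"
proof (rule ccontr)
  assume "absval (of_nat n :: 'a) \<noteq> 1"
  then have n: "absval (of_nat n :: 'a) < 1"
    using absval_of_nat_le[of n, where 'a='a] by simp
  have "coprime (int n) (int p)"
    using prime_imp_coprime[OF prime_p assms] by (simp add: coprime_commute)
  then obtain a b where "a * int n + b * int p = 1"
    using bezout_int[of "int n" "int p"] by auto
  then have "of_int a * of_nat n + of_int b * of_nat p = (1 :: 'a)"
    by (metis of_int_1 of_int_add of_int_mult of_int_of_nat_eq)
  moreover have "absval (of_int a * of_nat n :: 'a) < 1"
    using n mult_right_mono[OF absval_of_int_le[of a, where 'a='a], of "absval (of_nat n :: 'a)"]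
    by (simp add: absval_mult)
  moreover have "absval (of_int b * of_nat p :: 'a) < 1"
    using absval_of_int_le[of b, where 'a='a] p_gt_1
    by (simp add: absval_mult absval_p)
  ultimately show False
    using absval_add_le[of "of_int a * of_nat n :: 'a" "of_int b * of_nat p"] by simp
qed

section \<open>The radius of convergence and absolute values of factorials\<close>

lemma r_pos: "0 < r"
  using p_gt_1 by (simp add: exp_radius_def)

lemma r_less_1: "r < 1"
  using powr_less_mono[of "- 1 / (real p - 1)" 0 "real p"] p_gt_1
  by (simp add: exp_radius_def divide_less_0_iff)

lemma le_divide_r: "0 \<le> a \<Longrightarrow> a \<le> a / r"
  using r_pos r_less_1 by (simp add: pos_le_divide_eq mult_left_le)

lemma r_power: "r ^ (p - 1) = 1 / p"
proof -
  have "r ^ (p - 1) = r powr real (p - 1)"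
    using r_pos by (simp add: powr_realpow)
  also have "\<dots> = real p powr - 1"
    using p_gt_1 by (simp add: exp_radius_def powr_powr of_nat_diff)
  finally show ?thesis
    using p_gt_1 by (simp add: powr_minus_divide)
qed

text \<open>Factors prime to \<open>p\<close> have absolute value 1; the others are
  \<open>p\<close>, \<open>2 p\<close>, up to \<open>(n div p) p\<close>, and contribute a power of
  \<open>p\<close> and another factorial.\<close>

lemma absval_fact_div:
  "absval (fact n :: 'a) = (1 / p) ^ (n div p) * absval (fact (n div p) :: 'a)"
proof (induction n)
  case (Suc n)
  show ?case
  proof (cases "p dvd Suc n")
    case True
    then obtain k where k: "Suc n = p * k" by blast
    then obtain m where m: "k = Suc m" by (cases k) auto
    have "n div p = m"
      using div_Suc[of n p] k m p_gt_1 by (simp add: dvd_eq_mod_eq_0 split: if_splits)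
    moreover have "Suc n div p = Suc m"
      using k m p_gt_1 by simp
    moreover have "fact (Suc n) = (of_nat p * of_nat (Suc m) * fact n :: 'a)"
      unfolding fact_Suc by (simp only: k m of_nat_mult)
    moreover have "fact (Suc m) = (of_nat (Suc m) * fact m :: 'a)"
      by (simp only: fact_Suc)
    ultimately show ?thesis
      using Suc.IH by (simp only: absval_mult absval_p power_Suc) (simp add: mult_ac)
  next
    case False
    then have "Suc n div p = n div p"
      by (simp add: div_Suc dvd_eq_mod_eq_0)
    moreover have "fact (Suc n) = (of_nat (Suc n) * fact n :: 'a)"
      by (simp only: fact_Suc)
    ultimately show ?thesis
      using Suc.IH absval_of_nat_coprime[OF False] by (simp only: absval_mult)
  qed
qed simp

text \<open>This is Legendre's estimate that the exponent of \<open>p\<close> in \<open>n!\<close>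
  is at most \<open>(n - 1) / (p - 1)\<close>. The induction passes from \<open>n\<close> to
  \<open>n div p\<close>.\<close>

lemma absval_fact_ge: "0 < n \<Longrightarrow> r ^ (n - 1) \<le> absval (fact n :: 'a)"
proof (induction n rule: less_induct)
  case (less n)
  define m where "m = n div p"
  show ?case
  proof (cases "m = 0")
    case True
    then show ?thesis
      using absval_fact_div[of n] r_pos r_less_1 by (simp add: m_def power_le_one)
  next
    case False
    have "m < n"
      using less.prems p_gt_1 by (simp add: m_def)
    have "p * m \<le> n"
      by (simp add: m_def)
    \<comment> \<open>In the exponent of \<open>r\<close>, \<open>(p - 1) * m\<close> stands for the
      factor \<open>(1 / p) ^ m\<close>, and \<open>m - 1\<close> comes from the induction
      hypothesis.\<close>
    moreover have "(p - 1) * m + (m - 1) = p * m - 1"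
      using False p_gt_1 by (cases p; cases m) (simp_all add: algebra_simps)
    ultimately have "(p - 1) * m + (m - 1) \<le> n - 1"
      by linarith
    then have "r ^ (n - 1) \<le> r ^ ((p - 1) * m + (m - 1))"
      using r_pos r_less_1 by (intro power_decreasing) auto
    also have "\<dots> = (1 / p) ^ m * r ^ (m - 1)"
      by (simp only: power_add power_mult r_power)
    also have "\<dots> \<le> (1 / p) ^ m * absval (fact m :: 'a)"
      using less.IH[OF \<open>m < n\<close>] False by (intro mult_left_mono) auto
    also have "\<dots> = absval (fact n :: 'a)"
      using absval_fact_div[of n] by (simp add: m_def)
    finally show ?thesis .
  qed
qed

lemma absval_fact_pos: "0 < absval (fact n :: 'a)"
  by (simp add: less_le)

text \<open>Keeping the factor \<open>absval z\<close> apart shows that the linear term dominates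
  the later ones when \<open>absval z < r\<close>; \<open>absval_sums_eq\<close> asks for this
  form.\<close>

lemma absval_exp_term_Suc_le:
  fixes z :: 'a
  shows "absval (z ^ Suc n / fact (Suc n)) \<le> absval z * (absval z / r) ^ n"
proof -
  have "absval (z ^ Suc n / fact (Suc n)) = absval z ^ Suc n / absval (fact (Suc n) :: 'a)"
    by (simp only: absval_divide absval_power)
  also have "\<dots> \<le> absval z ^ Suc n / r ^ n"
    using absval_fact_ge[of "Suc n"] r_pos absval_fact_pos
    by (intro divide_left_mono mult_pos_pos) (simp_all del: fact_Suc)
  finally show ?thesis
    by (simp add: power_divide)
qed

lemma absval_exp_term_le:
  fixes z :: 'a
  shows "absval (z ^ n / fact n) \<le> (absval z / r) ^ n"
proof (cases n)
  case (Suc m)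
  have "absval (z ^ n / fact n) \<le> absval z * (absval z / r) ^ m"
    unfolding Suc by (rule absval_exp_term_Suc_le)
  also have "\<dots> \<le> absval z / r * (absval z / r) ^ m"
    using r_pos r_less_1 by (intro mult_right_mono) (simp_all add: le_divide_r)
  finally show ?thesis
    by (simp add: Suc)
qed simp

text \<open>\<open>Suc n\<close> divides \<open>fact (Suc n)\<close>, so the exponential term of the
  same degree is a majorant.\<close>

lemma absval_log_term_le:
  fixes z :: 'a
  shows "absval ((-1) ^ n * z ^ Suc n / of_nat (Suc n)) \<le> absval z * (absval z / r) ^ n"
proof -
  have *: "absval (fact (Suc n) :: 'a) \<le> absval (of_nat (Suc n) :: 'a)"
    using absval_of_nat_le[of "fact n", where 'a='a]
    by (simp only: fact_Suc absval_mult of_nat_fact) (simp add: mult_left_le)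
  have "absval ((-1) ^ n * z ^ Suc n / of_nat (Suc n)) =
      absval z ^ Suc n / absval (of_nat (Suc n) :: 'a)"
    by (simp only: absval_divide absval_power absval_mult) simp
  also have "\<dots> \<le> absval z ^ Suc n / absval (fact (Suc n) :: 'a)"
    using * absval_fact_pos order_less_le_trans[OF absval_fact_pos *]
    by (intro divide_left_mono mult_pos_pos) (simp_all del: fact_Suc of_nat_Suc)
  also have "\<dots> = absval (z ^ Suc n / fact (Suc n))"
    by (simp only: absval_divide absval_power)
  finally show ?thesis
    using absval_exp_term_Suc_le order_trans by blast
qed

lemma absval_div_r: "absval z < r \<Longrightarrow> 0 \<le> absval z / r \<and> absval z / r < 1" for z :: 'a
  using r_pos by simp

lemma padic_exp_sums:
  assumes "absval (z :: 'a) < r"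
  shows "(\<lambda>n. z ^ n / fact n) sums padic_exp z"
  unfolding padic_exp_def
  using absval_div_r[OF assms]
  by (intro summable_sums nonarch_summable_geometric[OF complete_UNIV absval_exp_term_le]) auto

lemma padic_log_sums:
  assumes "absval (z :: 'a) < r"
  shows "(\<lambda>n. (-1) ^ n * z ^ Suc n / of_nat (Suc n)) sums padic_log (1 + z)"
proof -
  have "summable (\<lambda>n. (-1) ^ n * z ^ Suc n / of_nat (Suc n))"
  proof (rule nonarch_summable_geometric[OF complete_UNIV])
    fix n
    have "absval z * (absval z / r) ^ n \<le> 1 * (absval z / r) ^ n"
      using assms r_less_1 r_pos by (intro mult_right_mono) auto
    then show "absval ((-1) ^ n * z ^ Suc n / of_nat (Suc n)) \<le> (absval z / r) ^ n"
      using absval_log_term_le[where z = z and n = n] by linarith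
  qed (use absval_div_r[OF assms] in auto)
  then show ?thesis
    by (auto simp: padic_log_def)
qed

text \<open>For nonzero \<open>z\<close> the terms after the first sum to at most
  \<open>absval z * (absval z / r)\<close>, less than \<open>absval z\<close>, so the first term
  decides. Serves both the logarithm and the exponential minus 1.\<close>

lemma absval_sums_eq:
  fixes z :: 'a
  assumes z: "absval z < r" and "f sums s" and "f 0 = z"
    and f: "\<And>n. absval (f n) \<le> absval z * (absval z / r) ^ n"
  shows "absval s = absval z"
proof -
  have \<rho>: "0 \<le> absval z / r" "absval z / r < 1"
    using absval_div_r[OF z] by auto
  have "absval (s - z) \<le> absval z * (absval z / r)"
  proof (rule sums_absval_le)
    show "(\<lambda>n. f n - (if n = 0 then f n else 0)) sums (s - z)"
      using sums_nonarch_diff[OF \<open>f sums s\<close> sums_single[of 0 f]] \<open>f 0 = z\<close> by simp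
    show "absval (f n - (if n = 0 then f n else 0)) \<le> absval z * (absval z / r)" for n
    proof (cases n)
      case (Suc m)
      have "(absval z / r) ^ n \<le> (absval z / r) ^ 1"
        using \<rho> Suc by (intro power_decreasing) auto
      then have "absval z * (absval z / r) ^ n \<le> absval z * (absval z / r)"
        by (intro mult_left_mono) auto
      with f[of n] Suc show ?thesis
        by simp
    qed (use \<rho> \<open>f 0 = z\<close> in \<open>simp del: times_divide_eq_right\<close>)
  qed
  moreover have "absval z * (absval z / r) < absval z" if "z \<noteq> 0"
    using that \<rho>
    by (metis absval_eq_0_iff absval_ge_0 less_le mult.right_neutral mult_less_cancel_left_pos)
  ultimately show ?thesis
    using order_antisym[OF _ absval_ge_0[of s]]
    by (cases "z = 0") (auto intro!: absval_eq_of_diff_less)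
qed

lemma absval_log:
  assumes "absval (z :: 'a) < r"
  shows "absval (padic_log (1 + z)) = absval z"
  by (rule absval_sums_eq[OF assms padic_log_sums[OF assms] _ absval_log_term_le]) simp

lemma absval_exp_minus_1:
  assumes "absval (z :: 'a) < r"
  shows "absval (padic_exp z - 1) = absval z"
proof (rule absval_sums_eq[OF assms])
  have "(\<lambda>n. \<Sum>i<Suc n. z ^ i / fact i) \<longlonglongrightarrow> padic_exp z"
    using padic_exp_sums[OF assms] unfolding sums_def by (rule LIMSEQ_Suc)
  then have "(\<lambda>n. (\<Sum>i<Suc n. z ^ i / fact i) + - 1) \<longlonglongrightarrow> padic_exp z + - 1"
    by (intro tendsto_add tendsto_const)
  then show "(\<lambda>n. z ^ Suc n / fact (Suc n)) sums (padic_exp z - 1)"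
    unfolding sums_def by (subst (asm) sum.lessThan_Suc_shift) simp
  show "absval (z ^ Suc n / fact (Suc n)) \<le> absval z * (absval z / r) ^ n" for n
    by (rule absval_exp_term_Suc_le)
qed simp

text \<open>The Cauchy product of the two series, regrouped by the binomial theorem;
  \<open>\<rho>\<close> is a common ratio for both factors.\<close>

lemma padic_exp_add:
  fixes z w :: 'a
  assumes "absval z < r" "absval w < r"
  shows "padic_exp (z + w) = padic_exp z * padic_exp w"
proof -
  define \<rho> where "\<rho> = max (absval z) (absval w) / r"
  have \<rho>: "0 \<le> \<rho>" "\<rho> < 1"
    using assms r_pos by (auto simp: \<rho>_def le_max_iff_disj)
  have le: "absval (u ^ n / fact n) \<le> \<rho> ^ n"
    if "absval u \<le> max (absval z) (absval w)" for u :: 'a and n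
  proof -
    have "(absval u / r) ^ n \<le> \<rho> ^ n"
      unfolding \<rho>_def using r_pos that by (intro power_mono divide_right_mono) auto
    with absval_exp_term_le[where z = u and n = n] show ?thesis
      by linarith
  qed
  have "(\<lambda>n. \<Sum>i\<le>n. z ^ i / fact i * (w ^ (n - i) / fact (n - i))) sums (padic_exp z * padic_exp w)"
    by (rule nonarch_Cauchy_product[OF complete_UNIV le le \<rho>])
      (simp_all add: padic_exp_sums assms)
  moreover have "(\<Sum>i\<le>n. z ^ i / fact i * (w ^ (n - i) / fact (n - i))) = (z + w) ^ n / fact n" for n
    unfolding binomial_ring sum_divide_distrib
    by (intro sum.cong) (auto simp: binomial_fact)
  moreover have "(\<lambda>n. (z + w) ^ n / fact n) sums padic_exp (z + w)"
    using absval_add_le[of z w] assms by (intro padic_exp_sums) auto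
  ultimately show ?thesis
    by (metis (no_types, lifting) sums_cong sums_unique2)
qed

text \<open>Transfers powers of the formal series \<open>log (1 + X)\<close>, which is
  \<open>fps_ln 1\<close>, to powers of the analytic logarithm.\<close>

lemma padic_log_power_sums:
  fixes z :: 'a
  assumes "absval z < r"
  shows "(\<lambda>n. fps_nth (fps_ln 1 ^ k) n * z ^ n) sums padic_log (1 + z) ^ k"
    and "absval (fps_nth (fps_ln 1 ^ k) n * z ^ n) \<le> (absval z / r) ^ n"
proof -
  have \<rho>: "0 \<le> absval z / r" "absval z / r < 1"
    using absval_div_r[OF assms] by auto
  have ln_sums: "(\<lambda>n. fps_nth (fps_ln 1) n * z ^ n) sums padic_log (1 + z)"
  proof -
    have "(\<lambda>n. fps_nth (fps_ln 1) (Suc n) * z ^ Suc n) sums padic_log (1 + z)"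
      using padic_log_sums[OF assms] by (simp add: fps_ln_nth)
    from sums_Suc[where f = "\<lambda>n. fps_nth (fps_ln 1) n * z ^ n", OF this] show ?thesis
      by simp
  qed
  have ln_le: "absval (fps_nth (fps_ln 1) n * z ^ n) \<le> (absval z / r) ^ n" for n
  proof (cases n)
    case (Suc m)
    have "fps_nth (fps_ln 1) n * z ^ n = (-1) ^ m * z ^ Suc m / of_nat (Suc m)"
      by (simp add: Suc fps_ln_nth)
    then have "absval (fps_nth (fps_ln 1) n * z ^ n) \<le> absval z * (absval z / r) ^ m"
      using absval_log_term_le[where z = z and n = m] by simp
    also have "\<dots> \<le> absval z / r * (absval z / r) ^ m"
      using r_pos r_less_1 by (intro mult_right_mono) (simp_all add: le_divide_r)
    finally show ?thesis
      by (simp add: Suc)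
  qed simp
  \<comment> \<open>Sum and bound are proved together because the bound for \<open>k\<close> is a
    hypothesis of the Cauchy product that yields \<open>Suc k\<close>.\<close>
  have "(\<lambda>n. fps_nth (fps_ln 1 ^ k) n * z ^ n) sums padic_log (1 + z) ^ k \<and>
    (\<forall>n. absval (fps_nth (fps_ln 1 ^ k) n * z ^ n) \<le> (absval z / r) ^ n)"
  proof (induction k)
    case 0
    have "(\<lambda>n. fps_nth (fps_ln 1 ^ 0) n * z ^ n) = (\<lambda>n. if n = 0 then 1 else 0)"
      by (auto simp: fun_eq_iff)
    with sums_single[of 0 "\<lambda>_. 1 :: 'a"] \<rho> show ?case
      by auto
  next
    case (Suc k)
    have eq: "fps_nth (fps_ln 1 * fps_ln 1 ^ k) n * z ^ n =
        (\<Sum>i\<le>n. fps_nth (fps_ln 1) i * z ^ i * (fps_nth (fps_ln 1 ^ k) (n - i) * z ^ (n - i)))"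
      for n
      unfolding fps_mult_nth sum_distrib_right atLeast0AtMost
      by (intro sum.cong) (auto simp: mult_ac simp flip: power_add)
    show ?case
      unfolding power_Suc eq
      using Suc.IH \<rho>(1)
      by (intro conjI allI nonarch_Cauchy_product[OF complete_UNIV ln_le _ \<rho> ln_sums]
          absval_Cauchy_product_le[OF ln_le]) auto
  qed
  then show "(\<lambda>n. fps_nth (fps_ln 1 ^ k) n * z ^ n) sums padic_log (1 + z) ^ k"
    and "absval (fps_nth (fps_ln 1 ^ k) n * z ^ n) \<le> (absval z / r) ^ n"
    by auto
qed

end

section \<open>Stirling numbers\<close>

lemma stirling1_0: "stirling1 0 k = (if k = 0 then 1 else 0)"
  by (simp add: stirling1_def)

lemma stirling1_Suc_0: "stirling1 (Suc n) 0 = - int n * stirling1 n 0"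
  by (simp add: stirling1_def)

lemma stirling1_Suc_Suc:
  "stirling1 (Suc n) (Suc k) = stirling1 n k - int n * stirling1 n (Suc k)"
  by (simp add: stirling1_def)

lemma stirling1_eq_0: "n < k \<Longrightarrow> stirling1 n k = 0"
proof (induction n arbitrary: k)
  case (Suc n)
  then show ?case
    by (cases k) (auto simp: stirling1_Suc_Suc)
qed (simp add: stirling1_0)

text \<open>Multiplying the derivative of \<open>log (1 + X) ^ k\<close> by \<open>1 + X\<close>
  gives \<open>k * log (1 + X) ^ (k - 1)\<close>; comparing coefficients produces the recurrence of
  the Stirling numbers.\<close>

lemma fps_ln_power_nth:
  "fps_nth (fps_ln 1 ^ k) n = fact k * of_int (stirling1 n k) / (fact n :: 'a::field_char_0)"
proof (induction n arbitrary: k)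
  case 0
  then show ?case
    by (simp add: stirling1_0 fps_power_zeroth power_0_left)
next
  case (Suc n)
  show ?case
  proof (cases k)
    case 0
    have "stirling1 (Suc n) 0 = 0"
      by (induction n) (simp_all add: stirling1_Suc_0)
    with 0 show ?thesis by simp
  next
    case (Suc j)
    define D :: "'a fps" where "D = fps_deriv (fps_ln 1 ^ Suc j)"
    have "(1 + fps_X) * D = of_nat (Suc j) * fps_ln 1 ^ j * ((1 + fps_X) * inverse (1 + fps_X))"
      by (simp add: D_def fps_deriv_power' fps_ln_deriv mult_ac del: of_nat_Suc power_Suc)
    also have "(1 + fps_X) * inverse (1 + fps_X) = (1 :: 'a fps)"
      by (rule inverse_mult_eq_1') simp
    finally have "fps_nth ((1 + fps_X) * D) n = of_nat (Suc j) * fps_nth (fps_ln 1 ^ j) n"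
      by (simp del: of_nat_Suc flip: fps_of_nat)
    \<comment> \<open>The factor \<open>fps_X\<close> contributes coefficient \<open>n - 1\<close>
      of \<open>D\<close>; for \<open>n = 0\<close> there is none, in agreement with the factor
      \<open>of_nat n\<close>.\<close>
    moreover have "fps_nth ((1 + fps_X) * D) n =
        of_nat (Suc n) * fps_nth (fps_ln 1 ^ Suc j) (Suc n) + of_nat n * fps_nth (fps_ln 1 ^ Suc j) n"
      by (cases n) (simp_all add: D_def ring_distribs(2) del: of_nat_Suc power_Suc)
    ultimately have "of_nat (Suc n) * fps_nth (fps_ln 1 ^ Suc j) (Suc n) =
        of_nat (Suc j) * (fact j * of_int (stirling1 n j) / fact n) -
        of_nat n * (fact (Suc j) * of_int (stirling1 n (Suc j)) / (fact n :: 'a))"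
      unfolding Suc.IH by (simp add: algebra_simps del: of_nat_Suc power_Suc fact_Suc)
    also have "\<dots> = of_nat (Suc n) * (fact (Suc j) * of_int (stirling1 (Suc n) (Suc j)) / fact (Suc n))"
      unfolding stirling1_Suc_Suc
      by (simp add: field_simps del: of_nat_Suc)
    finally show ?thesis
      unfolding Suc by (metis mult_left_cancel of_nat_neq_0)
  qed
qed

section \<open>Uniqueness of power series coefficients\<close>

context padic_complex_field
begin

text \<open>Lower coefficients vanish by induction. Scaling a fixed \<open>t\<close> by
  \<open>w = p ^ N\<close> makes all terms beyond \<open>m\<close> at most
  \<open>C * absval w ^ Suc m\<close>; as they cancel the term of index \<open>m\<close>,
  \<open>absval (d m * t ^ m)\<close> is at most \<open>C * absval w\<close>, which tends to
  0.\<close>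

lemma power_series_eq_0:
  fixes d :: "nat \<Rightarrow> 'a"
  assumes "0 < \<delta>" and d: "\<And>t. absval t < \<delta> \<Longrightarrow> (\<lambda>k. d k * t ^ k) sums 0"
  shows "d m = 0"
proof (induction m rule: less_induct)
  case (less m)
  obtain M where M: "(1 / real p) ^ M < \<delta>"
    using real_arch_pow_inv[OF \<open>0 < \<delta>\<close>, of "1 / p"] p_gt_1 by auto
  define t :: 'a where "t = of_nat (p ^ M)"
  have t: "absval t < \<delta>" "absval t > 0"
    using M p_gt_1 unfolding t_def absval_p_power by auto
  obtain C where C: "absval (d k * t ^ k) \<le> C" for k
  proof -
    have "convergent (\<lambda>k. absval (d k * t ^ k))"
      using summable_absval_tendsto_0 d[OF t(1)] by (auto simp: summable_def convergent_def)
    then obtain K where "\<forall>k. norm (absval (d k * t ^ k)) \<le> K"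
      using convergent_imp_Bseq BseqE by metis
    then show thesis
      using that by auto
  qed
  have "C \<ge> 0"
    using C[of 0] absval_ge_0 order_trans by blast
  have "absval (d m * t ^ m) \<le> C * (1 / p) ^ N" for N
  proof -
    define w :: 'a where "w = of_nat (p ^ N)"
    have w: "absval w = (1 / p) ^ N" "0 < absval w" "absval w \<le> 1"
      using p_gt_1 unfolding w_def absval_p_power by (auto simp: power_le_one)
    have "absval (t * w) < \<delta>"
      using t(1) mult_left_le[OF w(3) absval_ge_0[of t]] unfolding absval_mult by linarith
    \<comment> \<open>The whole series sums to 0, so the term of index \<open>m\<close> is minus the
      sum of all others.\<close>
    from sums_nonarch_diff[OF sums_single[of m "\<lambda>k. d k * (t * w) ^ k"] d[OF this]]
    have "(\<lambda>k. (if k = m then d k * (t * w) ^ k else 0) - d k * (t * w) ^ k) sums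
        (d m * (t * w) ^ m)"
      by simp
    then have "absval (d m * (t * w) ^ m) \<le> C * absval w ^ Suc m"
    proof (rule sums_absval_le)
      fix k
      consider "k < m" | "k = m" | "m < k" by linarith
      then show "absval ((if k = m then d k * (t * w) ^ k else 0) - d k * (t * w) ^ k)
          \<le> C * absval w ^ Suc m"
      proof cases
        case 1
        then show ?thesis using less.IH \<open>0 \<le> C\<close> w(2) by simp
      next
        case 2
        then show ?thesis using \<open>0 \<le> C\<close> w(2) by simp
      next
        case 3
        then have "absval (d k * (t * w) ^ k) = absval (d k * t ^ k) * absval w ^ k"
          by (simp add: absval_mult absval_power power_mult_distrib)
        also have "\<dots> \<le> C * absval w ^ Suc m"
          using C[of k] 3 w \<open>0 \<le> C\<close> by (intro mult_mono power_decreasing) auto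
        finally show ?thesis
          using 3 by simp
      qed
    qed
    then have "absval (d m * t ^ m) * absval w ^ m \<le> C * absval w * absval w ^ m"
      by (simp add: absval_mult absval_power power_mult_distrib mult_ac)
    then show ?thesis
      using w by (simp add: mult_le_cancel_right)
  qed
  moreover have "(\<lambda>N. C * (1 / p) ^ N) \<longlonglongrightarrow> C * 0"
    using p_gt_1 by (intro tendsto_mult_left LIMSEQ_power_zero) auto
  ultimately have "absval (d m * t ^ m) \<le> C * 0"
    by (intro LIMSEQ_le_const) auto
  then have "d m * t ^ m = 0"
    by (metis absval_eq_0_iff absval_ge_0 mult_zero_right order_antisym)
  with t(2) show ?case
    by auto
qed

end

section \<open>Riemann sums of the \<open>q\<close>-integral\<close>

text \<open>Groups the indices by their residue \<open>y\<close> modulo \<open>k\<close>.\<close>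

lemma sum_lessThan_mult:
  "(\<Sum>y<n * k. h y) = (\<Sum>y<k. \<Sum>j<n. h (y + j * k))" for k n :: nat
proof -
  have "(\<Sum>y<n * k. h y) = (\<Sum>j<n. \<Sum>y<k. h (y + j * k))"
    unfolding sum.nat_group[symmetric]
    using sum.shift_bounds_nat_ivl[of h 0 _ k] by (simp add: add.commute[of _ k] atLeast0LessThan)
  then show ?thesis
    by (simp add: sum.swap[of _ "{..<n}"])
qed

text \<open>The remainder consists of integer multiples of \<open>a ^ (k - i) * u ^ i\<close> with
  \<open>i \<ge> 2\<close>, so the bound is uniform in \<open>k\<close>. At \<open>k = 0\<close> the
  truncated exponent \<open>k - 1\<close> is multiplied by 0.\<close>

lemma absval_power_add_Taylor:
  fixes a u :: "'a::nonarch_field"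
  assumes "absval a \<le> 1" "absval u \<le> 1"
  shows "absval ((a + u) ^ k - a ^ k - of_nat k * a ^ (k - 1) * u) \<le> absval u ^ 2"
proof (induction k)
  case (Suc k)
  have "(a + u) ^ Suc k - a ^ Suc k - of_nat (Suc k) * a ^ (Suc k - 1) * u =
      (a + u) * ((a + u) ^ k - a ^ k - of_nat k * a ^ (k - 1) * u) + of_nat k * a ^ (k - 1) * u ^ 2"
    by (cases k) (simp_all add: algebra_simps power2_eq_square)
  moreover have "absval ((a + u) * ((a + u) ^ k - a ^ k - of_nat k * a ^ (k - 1) * u)) \<le> 1 * absval u ^ 2"
    unfolding absval_mult[of "a + u"]
    using assms Suc.IH by (intro mult_mono absval_add_leI) auto
  moreover have "absval (of_nat k * a ^ (k - 1) * u ^ 2) \<le> 1 * absval u ^ 2"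
    unfolding absval_mult[of "of_nat k * a ^ (k - 1)"] absval_power[of u]
    using assms by (intro mult_right_mono absval_mult_le_1 absval_of_nat_le absval_power_le_1) auto
  ultimately show ?case
    by (auto intro: absval_add_leI)
qed simp

text \<open>The constant 1 in both conditions makes the class closed under products, so that
  estimates for it are uniform in the exponent of a power.\<close>

definition nat_lipschitz :: "(nat \<Rightarrow> 'a::nonarch_field) \<Rightarrow> bool" where
  "nat_lipschitz h \<longleftrightarrow>
     (\<forall>y. absval (h y) \<le> 1) \<and> (\<forall>y m. absval (h (y + m) - h y) \<le> absval (of_nat m :: 'a))"

lemma nat_lipschitz_mult:
  fixes f g :: "nat \<Rightarrow> 'a::nonarch_field"
  assumes "nat_lipschitz f" "nat_lipschitz g"
  shows "nat_lipschitz (\<lambda>y. f y * g y)"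
  unfolding nat_lipschitz_def
proof (intro conjI allI)
  fix y m
  show "absval (f y * g y) \<le> 1"
    using assms by (simp add: nat_lipschitz_def absval_mult_le_1)
  have "f (y + m) * g (y + m) - f y * g y =
      f (y + m) * (g (y + m) - g y) + (f (y + m) - f y) * g y"
    by (simp add: algebra_simps)
  moreover have "absval (f (y + m) * (g (y + m) - g y)) \<le> 1 * absval (of_nat m :: 'a)"
    unfolding absval_mult using assms by (intro mult_mono) (auto simp: nat_lipschitz_def)
  moreover have "absval ((f (y + m) - f y) * g y) \<le> absval (of_nat m :: 'a) * 1"
    unfolding absval_mult using assms by (intro mult_mono) (auto simp: nat_lipschitz_def)
  ultimately show "absval (f (y + m) * g (y + m) - f y * g y) \<le> absval (of_nat m :: 'a)"
    by (auto intro: absval_add_leI)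
qed

lemma nat_lipschitz_power:
  "nat_lipschitz f \<Longrightarrow> nat_lipschitz (\<lambda>y. f y ^ k)"
  by (induction k) (simp add: nat_lipschitz_def, simp add: nat_lipschitz_mult)

text \<open>From \<open>N\<close> to \<open>Suc N\<close>, each residue class modulo
  \<open>p ^ N\<close> contributes \<open>p\<close> times one value up to errors of size
  \<open>(1 / p) ^ N\<close>; the multiplication by \<open>p\<close> shrinks the old sum by
  \<open>1 / p\<close>.\<close>

lemma (in padic_complex_field) absval_sum_nat_lipschitz_le:
  fixes h :: "nat \<Rightarrow> 'a"
  assumes h: "nat_lipschitz h"
  shows "absval (\<Sum>y<p ^ N. h y) \<le> p * (1 / p) ^ N"
proof (induction N)
  case 0
  have "absval (h 0) \<le> 1"
    using h by (simp add: nat_lipschitz_def)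
  then show ?case
    using p_gt_1 by simp
next
  case (Suc N)
  have "(\<Sum>y<p ^ Suc N. h y) = (\<Sum>y<p ^ N. \<Sum>j<p. h (y + j * p ^ N))"
    by (simp add: sum_lessThan_mult)
  also have "\<dots> = (\<Sum>y<p ^ N. \<Sum>j<p. h (y + j * p ^ N) - h y) + of_nat p * (\<Sum>y<p ^ N. h y)"
    by (simp add: sum_subtractf sum_distrib_left)
  finally have eq: "(\<Sum>y<p ^ Suc N. h y) = \<dots>" .
  have "absval (h (y + j * p ^ N) - h y) \<le> p * (1 / p) ^ Suc N" for y j
  proof -
    have "absval (h (y + j * p ^ N) - h y) \<le> absval (of_nat (j * p ^ N) :: 'a)"
      using h by (simp add: nat_lipschitz_def del: of_nat_mult)
    also have "\<dots> \<le> 1 * (1 / p) ^ N"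
      unfolding of_nat_mult absval_mult absval_p_power
      by (intro mult_right_mono absval_of_nat_le) auto
    finally show ?thesis
      using p_gt_1 by simp
  qed
  moreover have "absval (of_nat p * (\<Sum>y<p ^ N. h y)) \<le> p * (1 / p) ^ Suc N"
    unfolding absval_mult absval_p using Suc.IH p_gt_1 by (simp add: field_simps)
  ultimately show ?case
    unfolding eq by (intro absval_add_leI absval_sum_le) auto
qed

locale padic_q_integral = padic_complex_field p T
  for p and T :: "'a::nonarch_field itself" +
  fixes q :: 'a
  assumes absval_q_minus_1: "absval (q - 1) < exp_radius p"
begin

section \<open>Absolute values and addition rules of \<open>q\<close>-powers and
  \<open>q\<close>-numbers\<close>

lemma absval_log_q: "absval (padic_log q) = absval (q - 1)"
  using absval_log[OF absval_q_minus_1] by simp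

lemma absval_mult_log_q:
  "absval v \<le> 1 \<Longrightarrow> absval (v * padic_log q) < r"
  using absval_q_minus_1 mult_left_le_one_le[of "absval (q - 1)" "absval v"]
  by (simp add: absval_mult absval_log_q)

lemma q_pow_add:
  "absval v \<le> 1 \<Longrightarrow> absval w \<le> 1 \<Longrightarrow> q_pow q (v + w) = q_pow q v * q_pow q w"
  by (simp add: q_pow_def ring_distribs padic_exp_add absval_mult_log_q)

lemma absval_q_pow_minus_1:
  "absval v \<le> 1 \<Longrightarrow> absval (q_pow q v - 1) = absval v * absval (q - 1)"
  by (simp add: q_pow_def absval_exp_minus_1[OF absval_mult_log_q] absval_mult absval_log_q)

lemma absval_q_pow:
  assumes "absval v \<le> 1"
  shows "absval (q_pow q v) = 1"
proof -
  have "absval (q_pow q v - 1) < absval (1 :: 'a)"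
    using absval_mult_log_q[OF assms] r_less_1
    by (simp add: absval_q_pow_minus_1[OF assms] absval_mult absval_log_q)
  then show ?thesis
    using absval_eq_of_diff_less[of "q_pow q v" 1] by simp
qed

lemma q_pow_1: "q = 1 \<Longrightarrow> absval v \<le> 1 \<Longrightarrow> q_pow q v = 1"
  using absval_q_pow_minus_1[of v] by simp

text \<open>
  Only \<open>\<bar>q\<^sup>v - 1\<bar> = \<bar>v\<bar> \<bar>q - 1\<bar>\<close> is used here, so that \<open>exp (log q) = q\<close> is never needed.
\<close>

lemma absval_q_number:
  assumes "absval v \<le> 1"
  shows "absval (q_number q v) = absval v"
proof (cases "q = 1")
  case False
  have "absval (1 - q_pow q v) = absval v * absval (1 - q)"
    using absval_q_pow_minus_1[OF assms] absval_minus[of "1 - q"] absval_minus[of "1 - q_pow q v"]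
    by simp
  with False show ?thesis
    by (simp add: q_number_def absval_divide)
qed (simp add: q_number_def)

lemma q_number_add:
  assumes "absval v \<le> 1" "absval w \<le> 1"
  shows "q_number q (v + w) = q_number q v + q_pow q v * q_number q w"
proof (cases "q = 1")
  case True
  with q_pow_1[OF True assms(1)] show ?thesis
    by (simp add: q_number_def)
next
  case False
  then have "(1 - q_pow q v * q_pow q w) / (1 - q) =
      (1 - q_pow q v) / (1 - q) + q_pow q v * ((1 - q_pow q w) / (1 - q))"
    by (simp add: field_simps)
  with False show ?thesis
    by (simp add: q_number_def q_pow_add assms)
qed

lemma q_number_0: "q_number q 0 = 0"
  using absval_q_number[of 0] by simp

lemma q_pow_of_nat_add:
  "q_pow q (of_nat (m + n)) = q_pow q (of_nat m) * q_pow q (of_nat n)"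
  by (simp add: q_pow_add absval_of_nat_le)

text \<open>A finite geometric sum. With \<open>j = p\<close> it relates the denominators of
  consecutive Riemann sums.\<close>

lemma q_number_of_nat_mult:
  "q_number q (of_nat (j * m)) = q_number q (of_nat m) * (\<Sum>i<j. q_pow q (of_nat (i * m)))"
proof (induction j)
  case (Suc j)
  have "q_number q (of_nat (Suc j * m)) = q_number q (of_nat (j * m) + of_nat m)"
    by (simp add: add.commute)
  also have "\<dots> = q_number q (of_nat (j * m)) + q_pow q (of_nat (j * m)) * q_number q (of_nat m)"
    by (rule q_number_add) (rule absval_of_nat_le)+
  finally show ?case
    by (simp add: Suc.IH ring_distribs del: of_nat_mult)
qed (simp add: q_number_0)

lemma absval_q_number_p_power: "absval (q_number q (of_nat (p ^ N))) = (1 / p) ^ N"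
  using absval_q_number[OF absval_of_nat_le, of "p ^ N"] by (simp only: absval_p_power)

lemma q_number_p_power_nonzero: "q_number q (of_nat (p ^ N)) \<noteq> 0"
  using absval_q_number_p_power[of N] p_gt_1 absval_eq_0_iff[of "q_number q (of_nat (p ^ N))"]
  by (simp del: absval_eq_0_iff of_nat_power)

lemma nat_lipschitz_q_pow: "nat_lipschitz (\<lambda>y. q_pow q (of_nat y))"
  unfolding nat_lipschitz_def
proof (intro conjI allI)
  fix y m :: nat
  show "absval (q_pow q (of_nat y)) \<le> 1"
    by (simp add: absval_q_pow absval_of_nat_le)
  have "q_pow q (of_nat (y + m)) - q_pow q (of_nat y) =
      q_pow q (of_nat y) * (q_pow q (of_nat m) - 1)"
    by (simp only: q_pow_of_nat_add right_diff_distrib mult_1_right)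
  then have "absval (q_pow q (of_nat (y + m)) - q_pow q (of_nat y)) =
      absval (of_nat m :: 'a) * absval (q - 1)"
    by (simp add: absval_mult absval_q_pow absval_q_pow_minus_1 absval_of_nat_le)
  also have "\<dots> \<le> absval (of_nat m :: 'a)"
    using absval_q_minus_1 r_less_1 by (intro mult_left_le) auto
  finally show "absval (q_pow q (of_nat (y + m)) - q_pow q (of_nat y)) \<le> absval (of_nat m :: 'a)" .
qed

end

section \<open>Riemann sums for the Carlitz polynomials\<close>

locale carlitz = padic_q_integral p T q
  for p and T :: "'a::nonarch_field itself" and q +
  fixes x :: 'a
  assumes absval_x: "absval x \<le> 1"
begin

lemma absval_x_add: "absval (x + of_nat y) \<le> 1"
  by (intro absval_add_leI absval_x absval_of_nat_le)

lemma q_number_x_add: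
  "q_number q (x + of_nat (y + m)) =
    q_number q (x + of_nat y) + q_pow q x * q_pow q (of_nat y) * q_number q (of_nat m)"
  using q_number_add[OF absval_x_add absval_of_nat_le, of y m]
  by (simp add: q_pow_add absval_x absval_of_nat_le add.assoc)

lemma nat_lipschitz_q_number: "nat_lipschitz (\<lambda>y. q_number q (x + of_nat y))"
  unfolding nat_lipschitz_def q_number_x_add
  by (auto simp: absval_q_number absval_mult absval_q_pow absval_x absval_x_add absval_of_nat_le)

definition riemann_sum :: "nat \<Rightarrow> nat \<Rightarrow> 'a" where
  "riemann_sum N k = 1 / q_number q (of_nat (p ^ N)) *
     (\<Sum>y<p ^ N. q_number q (x + of_nat y) ^ k * q_pow q (of_nat y))"

text \<open>The Lipschitz bound on the numerator does not depend on \<open>k\<close>, and the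
  denominator has absolute value \<open>(1 / p) ^ N\<close>. This uniformity permits the later
  interchange with the exponential series.\<close>

lemma absval_riemann_sum_le: "absval (riemann_sum N k) \<le> p"
proof -
  have "absval (riemann_sum N k) =
      absval (\<Sum>y<p ^ N. q_number q (x + of_nat y) ^ k * q_pow q (of_nat y)) / (1 / p) ^ N"
    unfolding riemann_sum_def absval_mult absval_divide absval_q_number_p_power by simp
  also have "\<dots> \<le> p * (1 / p) ^ N / (1 / p) ^ N"
    by (intro divide_right_mono absval_sum_nat_lipschitz_le nat_lipschitz_mult nat_lipschitz_power
        nat_lipschitz_q_number nat_lipschitz_q_pow) simp
  finally show ?thesis
    using p_gt_1 by simp
qed

text \<open>
  Grouping the \<open>p\<^sup>N\<^sup>+\<^sup>1\<close> terms by residue classes modulo \<open>p\<^sup>N\<close>, the first-order part of the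
  difference is itself a Lipschitz sum over \<open>p\<^sup>N\<close> terms, hence small.
\<close>

lemma absval_riemann_sum_diff_le:
  "absval (riemann_sum (Suc N) k - riemann_sum N k) \<le> p ^ 2 * (1 / p) ^ N"
proof -
  define M where "M = p ^ N"
  define a where "a y = q_number q (x + of_nat y)" for y :: nat
  define e where "e y = q_pow q (of_nat y)" for y :: nat
  define B where "B y = q_number q (of_nat y)" for y :: nat
  \<comment> \<open>\<open>D\<close> is the quotient of the two denominators and brings both Riemann
    sums over the same one.\<close>
  define D where "D = (\<Sum>j<p. e (j * M))"
  \<comment> \<open>\<open>u y j\<close> is the increment of \<open>a\<close> from \<open>y\<close>
    to \<open>y + j * M\<close>, and \<open>\<epsilon> y j\<close> the second-order Taylor remainder
    of the \<open>k\<close>-th power.\<close>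
  define u where "u y j = q_pow q x * e y * B (j * M)" for y j
  define \<epsilon> where "\<epsilon> y j = (a y + u y j) ^ k - a y ^ k - of_nat k * a y ^ (k - 1) * u y j" for y j
  have e_add: "e (m + n) = e m * e n" for m n
    by (simp add: e_def q_pow_of_nat_add del: of_nat_add)
  have a_add: "a (y + j * M) = a y + u y j" for y j
    by (simp add: a_def u_def e_def B_def q_number_x_add del: of_nat_add of_nat_mult)
  have e1: "absval (e y) = 1" for y
    by (simp add: e_def absval_q_pow absval_of_nat_le)
  have B_le: "absval (B (j * M)) \<le> (1 / p) ^ N" for j
  proof -
    have "absval (B (j * M)) = absval (of_nat j :: 'a) * (1 / p) ^ N"
      unfolding B_def absval_q_number[OF absval_of_nat_le]
      unfolding M_def of_nat_mult absval_mult absval_p_power ..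
    also have "\<dots> \<le> 1 * (1 / p) ^ N"
      by (intro mult_right_mono absval_of_nat_le) simp
    finally show ?thesis by simp
  qed
  have u_le: "absval (u y j) \<le> (1 / p) ^ N" for y j
    using B_le by (simp add: u_def absval_mult e1 absval_q_pow absval_x)
  have p_le_1: "(1 / real p) ^ N \<le> 1"
    using p_gt_1 by (simp add: power_le_one)
  have \<epsilon>_le: "absval (\<epsilon> y j) \<le> p * ((1 / p) ^ N) ^ 2" for y j
  proof -
    have "absval (\<epsilon> y j) \<le> absval (u y j) ^ 2"
      unfolding \<epsilon>_def using u_le[of y j] p_le_1
      by (intro absval_power_add_Taylor) (auto simp: a_def absval_q_number absval_x_add)
    also have "\<dots> \<le> 1 * ((1 / p) ^ N) ^ 2"
      using u_le[of y j] by (simp add: power_mono)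
    also have "\<dots> \<le> p * ((1 / p) ^ N) ^ 2"
      using p_gt_1 by (intro mult_right_mono) auto
    finally show ?thesis .
  qed
  have BS: "B (p ^ Suc N) = B M * D"
    unfolding B_def D_def e_def M_def power_Suc by (rule q_number_of_nat_mult)
  have nz: "B M \<noteq> 0" "B (p ^ Suc N) \<noteq> 0"
    unfolding B_def M_def by (rule q_number_p_power_nonzero)+
  then have "D \<noteq> 0"
    using BS by auto
  have "(\<Sum>y<p ^ Suc N. a y ^ k * e y) - D * (\<Sum>y<M. a y ^ k * e y) =
      (\<Sum>y<M. \<Sum>j<p. a (y + j * M) ^ k * e (y + j * M) - e (j * M) * (a y ^ k * e y))"
    by (simp add: sum_lessThan_mult M_def D_def sum_product sum_subtractf sum.swap[of _ "{..<p}"])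
  \<comment> \<open>The terms \<open>a y ^ k\<close> cancel; the linear terms separate into a factor
    in \<open>j\<close> and one in \<open>y\<close>.\<close>
  also have "\<dots> = (\<Sum>y<M. \<Sum>j<p.
      (B (j * M) * e (j * M)) * (of_nat k * q_pow q x * (a y ^ (k - 1) * e y ^ 2)) +
      \<epsilon> y j * (e y * e (j * M)))"
    unfolding a_add e_add
    by (intro sum.cong refl) (simp add: \<epsilon>_def u_def algebra_simps power2_eq_square)
  also have "\<dots> = (\<Sum>j<p. B (j * M) * e (j * M)) *
      (of_nat k * q_pow q x * (\<Sum>y<M. a y ^ (k - 1) * e y ^ 2)) +
      (\<Sum>y<M. \<Sum>j<p. \<epsilon> y j * (e y * e (j * M)))"
    by (simp add: sum.distrib sum_product sum_distrib_left sum.swap[of _ "{..<M}"] mult_ac)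
  finally have eq: "(\<Sum>y<p ^ Suc N. a y ^ k * e y) - D * (\<Sum>y<M. a y ^ k * e y) = \<dots>" .
  \<comment> \<open>Both parts have two factors \<open>(1 / p) ^ N\<close>: the linear one from
    \<open>B (j * M)\<close> and from the Lipschitz sum over \<open>y\<close>, the remainder because
    it is quadratic in \<open>u\<close>.\<close>
  have "absval ((\<Sum>y<p ^ Suc N. a y ^ k * e y) - D * (\<Sum>y<M. a y ^ k * e y)) \<le> p * ((1 / p) ^ N) ^ 2"
    unfolding eq
  proof (rule absval_add_leI)
    have "absval (\<Sum>y<M. a y ^ (k - 1) * e y ^ 2) \<le> p * (1 / p) ^ N"
      unfolding M_def a_def e_def
      by (intro absval_sum_nat_lipschitz_le nat_lipschitz_mult nat_lipschitz_power
          nat_lipschitz_q_number nat_lipschitz_q_pow)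
    then have Lip: "absval (of_nat k * q_pow q x) * absval (\<Sum>y<M. a y ^ (k - 1) * e y ^ 2)
        \<le> 1 * (p * (1 / p) ^ N)"
      by (intro mult_mono absval_mult_le_1 absval_of_nat_le) (auto simp: absval_q_pow absval_x)
    have "absval (\<Sum>j<p. B (j * M) * e (j * M)) \<le> (1 / p) ^ N"
      by (rule absval_sum_le) (auto simp: absval_mult e1 B_le)
    from mult_mono[OF this Lip] have "absval (\<Sum>j<p. B (j * M) * e (j * M)) *
        (absval (of_nat k * q_pow q x) * absval (\<Sum>y<M. a y ^ (k - 1) * e y ^ 2)) \<le>
        (1 / p) ^ N * (1 * (p * (1 / p) ^ N))"
      by simp
    then show "absval ((\<Sum>j<p. B (j * M) * e (j * M)) *
        (of_nat k * q_pow q x * (\<Sum>y<M. a y ^ (k - 1) * e y ^ 2))) \<le> p * ((1 / p) ^ N) ^ 2"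
      by (simp only: absval_mult) (simp add: power2_eq_square mult_ac)
    show "absval (\<Sum>y<M. \<Sum>j<p. \<epsilon> y j * (e y * e (j * M))) \<le> p * ((1 / p) ^ N) ^ 2"
      using \<epsilon>_le by (intro absval_sum_le) (auto simp: absval_mult e1)
  qed
  moreover have "riemann_sum (Suc N) k - riemann_sum N k =
      ((\<Sum>y<p ^ Suc N. a y ^ k * e y) - D * (\<Sum>y<M. a y ^ k * e y)) / B (p ^ Suc N)"
  proof -
    have "riemann_sum (Suc N) k = (\<Sum>y<p ^ Suc N. a y ^ k * e y) / B (p ^ Suc N)"
      by (simp only: riemann_sum_def a_def e_def B_def times_divide_eq_left mult_1_left)
    moreover have "riemann_sum N k = (\<Sum>y<M. a y ^ k * e y) / B M"
      by (simp only: riemann_sum_def a_def e_def B_def M_def times_divide_eq_left mult_1_left)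
    ultimately show ?thesis
      using nz(1) \<open>D \<noteq> 0\<close> unfolding BS by (simp add: diff_divide_distrib)
  qed
  \<comment> \<open>The division uses up one of the two factors \<open>(1 / p) ^ N\<close>; the
    other one forces convergence.\<close>
  ultimately have "absval (riemann_sum (Suc N) k - riemann_sum N k) \<le>
      p * ((1 / p) ^ N) ^ 2 / (1 / p) ^ Suc N"
    by (simp only: absval_divide B_def absval_q_number_p_power)
      (intro divide_right_mono, auto)
  also have "\<dots> = p ^ 2 * (1 / p) ^ N"
    using p_gt_1 by (simp add: power2_eq_square)
  finally show ?thesis .
qed

text \<open>The \<open>lim\<close> in \<open>q_integral\<close> is known to be an actual limit only
  once convergence is established; this follows from completeness and vanishing consecutive
  differences.\<close>

lemma riemann_sum_tendsto: "(\<lambda>N. riemann_sum N k) \<longlonglongrightarrow> carlitz_bernoulli p k q x"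
proof -
  have "(\<lambda>N. p ^ 2 * (1 / real p) ^ N) \<longlonglongrightarrow> real (p ^ 2) * 0"
    using p_gt_1 by (intro tendsto_mult_left LIMSEQ_power_zero) auto
  then have "(\<lambda>N. absval (riemann_sum (Suc N) k - riemann_sum N k)) \<longlonglongrightarrow> 0"
    by (intro absval_tendsto_0I[OF absval_riemann_sum_diff_le]) simp
  then have "convergent (\<lambda>N. riemann_sum N k)"
    by (intro nonarch_convergentI complete_UNIV)
  then show ?thesis
    by (simp add: convergent_LIMSEQ_iff carlitz_bernoulli_def q_integral_def riemann_sum_def)
qed

lemma absval_carlitz_bernoulli_le: "absval (carlitz_bernoulli p k q x) \<le> p"
  using LIMSEQ_le_const2[OF tendsto_absval[OF riemann_sum_tendsto]] absval_riemann_sum_le by blast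

section \<open>The generating function\<close>

lemma q_integral_degenerate_exp_sums:
  fixes lam t :: 'a
  assumes "lam \<noteq> 0" and lam_t: "absval (lam * t) < r" and t: "absval t < r"
  shows "(\<lambda>k. (padic_log (1 + lam * t) / lam) ^ k / fact k * carlitz_bernoulli p k q x) sums
    q_integral p q (\<lambda>y. degenerate_exp lam t (q_number q (x + y)))"
proof -
  define L where "L = padic_log (1 + lam * t) / lam"
  define S where "S N = 1 / q_number q (of_nat (p ^ N)) *
    (\<Sum>y<p ^ N. degenerate_exp lam t (q_number q (x + of_nat y)) * q_pow q (of_nat y))" for N
  \<comment> \<open>With this, the assumption on \<open>t\<close> puts \<open>a * L\<close> inside
    the radius of the exponential whenever \<open>absval a \<le> 1\<close>.\<close>
  have L: "absval L = absval t"
    using \<open>lam \<noteq> 0\<close> by (simp add: L_def absval_divide absval_log[OF lam_t] absval_mult)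
  have deg: "(\<lambda>k. a ^ k * (L ^ k / fact k)) sums degenerate_exp lam t a" if "absval a \<le> 1" for a
  proof -
    have "absval (a * L) < r"
      using t that mult_left_le_one_le[of "absval t" "absval a"] by (simp add: absval_mult L)
    from padic_exp_sums[OF this] show ?thesis
      by (simp add: degenerate_exp_def L_def power_mult_distrib power_divide)
  qed
  have S: "(\<lambda>k. L ^ k / fact k * riemann_sum N k) sums S N" for N
  proof -
    have "(\<lambda>k. \<Sum>y<p ^ N. q_pow q (of_nat y) * (q_number q (x + of_nat y) ^ k * (L ^ k / fact k))) sums
      (\<Sum>y<p ^ N. q_pow q (of_nat y) * degenerate_exp lam t (q_number q (x + of_nat y)))"
      by (intro sums_sum sums_nonarch_mult deg) (simp add: absval_q_number absval_x_add)
    from sums_nonarch_mult[OF this, of "1 / q_number q (of_nat (p ^ N))"] show ?thesis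
      by (simp add: S_def riemann_sum_def sum_distrib_left mult_ac)
  qed
  have bound: "absval (L ^ k / fact k * riemann_sum N k) \<le> (absval t / r) ^ k * p" for N k
    using absval_exp_term_le[of L k] absval_riemann_sum_le[of N k] r_pos
    unfolding absval_mult[of "L ^ k / fact k"] L by (intro mult_mono) auto
  have "(\<lambda>k. (absval t / r) ^ k * p) \<longlonglongrightarrow> 0 * real p"
    using absval_div_r[OF t] by (intro tendsto_mult_right LIMSEQ_power_zero) auto
  then have lim: "(\<lambda>k. (absval t / r) ^ k * p) \<longlonglongrightarrow> 0"
    by simp
  \<comment> \<open>The limit parameter is \<open>N\<close> and the series index is
    \<open>k\<close>; the majorant is a geometric sequence because the Riemann sums are bounded
    uniformly.\<close>
  note tannery = nonarch_tannery[OF complete_UNIV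
      tendsto_nonarch_mult_left[OF riemann_sum_tendsto] bound lim S]
  have "q_integral p q (\<lambda>y. degenerate_exp lam t (q_number q (x + y))) = lim S"
    by (simp only: q_integral_def S_def[abs_def])
  also have "\<dots> = (\<Sum>k. L ^ k / fact k * carlitz_bernoulli p k q x)"
    using tannery(1) by (rule limI)
  finally show ?thesis
    using tannery(2) by (simp add: L_def)
qed

lemma stirling_sums_q_integral_degenerate_exp:
  fixes lam t :: 'a
  assumes "lam \<noteq> 0" and lam_t: "absval (lam * t) < r" and t: "absval t < r"
  shows "(\<lambda>n. (\<Sum>l\<le>n. of_int (stirling1 n l) * lam ^ (n - l) * carlitz_bernoulli p l q x)
      * t ^ n / fact n) sums
    q_integral p q (\<lambda>y. degenerate_exp lam t (q_number q (x + y)))"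
proof -
  define \<beta> where "\<beta> k = carlitz_bernoulli p k q x" for k
  define s where "s k = (padic_log (1 + lam * t) / lam) ^ k / fact k * \<beta> k" for k
  define f where "f k n = of_int (stirling1 n k) * lam ^ (n - k) * \<beta> k * (t ^ n / fact n)" for k n
  \<comment> \<open>\<open>w\<close> is whichever of \<open>t\<close> and \<open>lam * t\<close> has
    the larger absolute value. For \<open>k \<le> n\<close>, \<open>lam ^ (n - k) * t ^ n\<close>
    equals \<open>(lam * t) ^ (n - k) * t ^ k\<close> and is bounded by \<open>absval w ^ n\<close>,
    whatever the size of \<open>lam\<close>.\<close>
  obtain w :: 'a where w: "absval w < r" "absval (lam * t) \<le> absval w" "absval t \<le> absval w"
    using lam_t t that[of t] that[of "lam * t"] by linarith
  have "f k sums s k" for k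
  proof -
    \<comment> \<open>For \<open>n < k\<close> the exponent \<open>n - k\<close> truncates, but both
      sides vanish with the Stirling number.\<close>
    have "f k n = \<beta> k / (lam ^ k * fact k) * (fps_nth (fps_ln 1 ^ k) n * (lam * t) ^ n)" for n
    proof (cases "k \<le> n")
      case True
      with \<open>lam \<noteq> 0\<close> show ?thesis
        by (simp add: f_def fps_ln_power_nth power_mult_distrib power_diff)
    qed (simp add: f_def fps_ln_power_nth stirling1_eq_0)
    then have "f k = (\<lambda>n. \<beta> k / (lam ^ k * fact k) * (fps_nth (fps_ln 1 ^ k) n * (lam * t) ^ n))"
      by (rule ext)
    moreover have "s k = \<beta> k / (lam ^ k * fact k) * padic_log (1 + lam * t) ^ k"
      by (simp add: s_def power_divide)
    ultimately show ?thesis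
      using sums_nonarch_mult[OF padic_log_power_sums(1)[OF lam_t]] by (simp only:)
  qed
  moreover have "absval (f k n) \<le> p * (absval w / r) ^ n" for k n
  proof (cases "k \<le> n")
    case True
    have "absval (lam ^ (n - k) * t ^ n / fact n) =
        absval (lam * t) ^ (n - k) * absval t ^ k / absval (fact n :: 'a)"
      using True by (simp add: absval_mult absval_divide absval_power power_mult_distrib mult.assoc
          flip: power_add)
    also have "\<dots> \<le> absval w ^ (n - k) * absval w ^ k / absval (fact n :: 'a)"
      using w by (intro divide_right_mono mult_mono power_mono) auto
    also have "\<dots> = absval (w ^ n / fact n)"
      using True by (simp add: absval_divide absval_power flip: power_add)
    also have "\<dots> \<le> (absval w / r) ^ n"
      by (rule absval_exp_term_le)
    finally have "absval (lam ^ (n - k) * t ^ n / fact n) \<le> (absval w / r) ^ n" .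
    moreover have "absval (of_int (stirling1 n k) * \<beta> k) \<le> 1 * real p"
      unfolding absval_mult \<beta>_def
      by (intro mult_mono absval_of_int_le absval_carlitz_bernoulli_le) auto
    ultimately have "absval (of_int (stirling1 n k) * \<beta> k) *
        absval (lam ^ (n - k) * t ^ n / fact n) \<le> (1 * real p) * (absval w / r) ^ n"
      by (intro mult_mono[OF _ _ _ absval_ge_0]) auto
    then show ?thesis
      by (simp add: f_def absval_mult absval_divide mult_ac)
  qed (use r_pos in \<open>simp add: f_def stirling1_eq_0\<close>)
  moreover have "(\<lambda>n. p * (absval w / r) ^ n) \<longlonglongrightarrow> real p * 0"
    using absval_div_r[OF w(1)] by (intro tendsto_mult_left LIMSEQ_power_zero) auto
  ultimately obtain S where "(\<lambda>n. \<Sum>k\<le>n. f k n) sums S" "s sums S"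
    using sums_triangular_swap[of f "\<lambda>n. p * (absval w / r) ^ n" s] complete_UNIV
    by (auto simp: f_def stirling1_eq_0)
  moreover from \<open>s sums S\<close> have "S = q_integral p q (\<lambda>y. degenerate_exp lam t (q_number q (x + y)))"
    using q_integral_degenerate_exp_sums[OF assms] unfolding s_def \<beta>_def by (rule sums_unique2)
  ultimately show ?thesis
    by (simp add: f_def \<beta>_def sum_distrib_right sum_divide_distrib)
qed

end

text \<open>Some integer lies at distance less than 1 from \<open>x\<close>, and integers have
  absolute value at most 1.\<close>

lemma absval_padic_ints_le:
  assumes "x \<in> (padic_ints :: 'a::nonarch_field set)"
  shows "absval x \<le> 1"
proof -
  obtain k :: int where "dist (of_int k) x < 1"
    using assms zero_less_one unfolding padic_ints_def closure_approachable by blast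
  then have "absval (of_int k - x) \<le> 1"
    by (simp add: dist_absval)
  from absval_diff_leI[OF absval_of_int_le this, of k] show ?thesis
    by simp
qed

theorem theorem2:
  fixes p n :: nat and q lam x :: "'a::nonarch_field"
  assumes "prime p"
    and "padic_complex p TYPE('a)"
    and "absval (q - 1) < exp_radius p"
    and "lam \<noteq> 0"
    and "x \<in> padic_ints"
  shows "degenerate_carlitz_bernoulli p n q x lam =
    (\<Sum>l=0..n. of_int (stirling1 n l) * lam ^ (n - l) * carlitz_bernoulli p l q x)"
proof -
  interpret carlitz p "TYPE('a)" q x
    using assms by unfold_locales (auto intro: absval_padic_ints_le)
  define b where "b n = (\<Sum>l\<le>n. of_int (stirling1 n l) * lam ^ (n - l) * carlitz_bernoulli p l q x)" for n
  let ?P = "\<lambda>b :: nat \<Rightarrow> 'a. \<forall>t. absval (lam * t) < exp_radius p \<and> absval t < exp_radius p \<longrightarrow>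
    (\<lambda>k. b k * t ^ k / fact k) sums q_integral p q (\<lambda>y. degenerate_exp lam t (q_number q (x + y)))"
  have lam: "0 < absval lam"
    using \<open>lam \<noteq> 0\<close> by (simp add: less_le)
  have "?P b"
    using stirling_sums_q_integral_degenerate_exp[OF \<open>lam \<noteq> 0\<close>] by (simp add: b_def)
  \<comment> \<open>The definite description also requires uniqueness: two solutions differ by a
    power series vanishing near 0. The minimum below keeps both \<open>t\<close> and
    \<open>lam * t\<close> inside the radius.\<close>
  moreover have "c = b" if "?P c" for c
  proof
    fix m
    have "(c m - b m) / fact m = 0"
    proof (rule power_series_eq_0)
      show "0 < min r (r / absval lam)"
        using r_pos lam by simp
      fix t :: 'a assume "absval t < min r (r / absval lam)"
      then have "absval (lam * t) < r" "absval t < r"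
        using \<open>lam \<noteq> 0\<close> by (simp_all add: absval_mult pos_less_divide_eq lam mult.commute)
      with \<open>?P b\<close> \<open>?P c\<close> have "(\<lambda>k. c k * t ^ k / fact k - b k * t ^ k / fact k) sums 0"
        using sums_nonarch_diff by fastforce
      then show "(\<lambda>k. (c k - b k) / fact k * t ^ k) sums 0"
        by (simp add: diff_divide_distrib left_diff_distrib)
    qed
    then show "c m = b m"
      by simp
  qed
  ultimately have "(THE b. ?P b) = b"
    by (rule the_equality)
  then show ?thesis
    unfolding degenerate_carlitz_bernoulli_def by (simp add: b_def atLeast0AtMost)
qed

end
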